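(* Let $S=\{(x_1,y_1),\dots,(x_m,y_m)\}$ be drawn i.i.d. from a distribution $\mathcal D$ on $\mathbb R^d\times\{+1,-1\}$, let $\lambda_1,\lambda_2\ge 0$, $C>0$, and let $\alpha^*$ denote the optimal solution of the dual problem of ODM$^L$ (linear kernel) $$\min_{\alpha\in\mathbb R^m}\ \tfrac12\alpha^\top H\alpha+\Big(\tfrac{\lambda_2}{m}He-e\Big)^\top\alpha\quad\text{s.t. } 0\le\alpha_i\le \tfrac Cm,\ i=1,\dots,m,$$ where $e$ is the all-one vector, $H=YG(I+AG)^{-1}Y$, $X=[x_1,\dots,x_m]$, $G=X^\top X$, $y=[y_1,\dots,y_m]^\top$, $Y=\mathrm{diag}(y_1,\dots,y_m)$, $A=\frac{2\lambda_1(mI-yy^\top)}{m^2}$. Then $$\mathbb E[R(\alpha^* )]\le\frac{\mathbb E\big[\sum_{i\in I_1}\alpha_i^*h_{ii}+|I_2|\big]}{m},$$ where $h_{ii}$ is the $(i,i)$ entry of $H$, $I_1=\{i\mid 0<\alpha_i^*<C/m\}$, $I_2=\{i\mid\alpha_i^*=C/m\}$, and expectations are over the draw of $S$.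
   Context: Primal problem (ODM$^L$): $\min_{w,\xi}\ \frac12 w^\top w+\lambda_1\hat\gamma-\lambda_2\bar\gamma+\frac Cm\sum_{i=1}^m\xi_i$ subject to $y_iw^\top x_i\ge 1-\xi_i$, $\xi_i\ge0$ for all $i$, where $\bar\gamma=\frac1m\sum_i y_iw^\top x_i$ is the margin mean and $\hat\gamma=\frac1m\sum_i(y_iw^\top x_i-\bar\gamma)^2$ is the margin variance. A dual vector $\alpha$ corresponds to the primal vector $w=X(I+AG)^{-1}Y(\frac{\lambda_2}{m}e+\alpha)$, and the resulting classifier is $x\mapsto\mathrm{sgn}(w^\top x)$; an example $(x_i,y_i)$ is misclassified by $w$ if $y_iw^\top x_i<0$. $R(\alpha)$ is the probability of test error of the learned classifier. Its expectation is evaluated through the leave-one-out identity $$\mathbb E[R(\alpha)]=\frac{\mathbb E[\mathcal L((x_1,y_1),\dots,(x_m,y_m))]}{m},$$ where $\mathcal L((x_1,y_1),\dots,(x_m,y_m))$ is the number of errors in the leave-one-out procedure, i.e. the number of indices $i\in\{1,\dots,m\}$ such that $(x_i,y_i)$ is misclassified by the classifier $w^i$ learned with example $i$ left out. Here leaving out example $i$ means that $w^i$ is the primal vector corresponding to $\alpha^i$, a minimizer of the same dual objective over the same box with the additional constraint $\alpha_i=0$.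
   Formalization: The leave-one-out identity E[R(α* )] = E[L]/m fails in general for the true test error (e.g. m=d=1, x=1, random label, λ2≥2), so the bound is stated for E[L]/m unconditionally and for E[R(α* )] with this identity as an explicit hypothesis. *)

theory Defs
  imports "HOL-Probability.Probability"
begin

text \<open>
  A sample of size \<open>m = CARD('m)\<close> is a function \<open>S\<close> on the index type, with
  \<open>S i = (x\<^sub>i, y\<^sub>i)\<close>; the label \<open>y\<^sub>i\<close> is a real number which the distributions below
  confine to \<open>{-1, 1}\<close>.
\<close>

type_synonym 'd example = "(real ^ 'd) \<times> real"
type_synonym ('m, 'd) sample = "'m \<Rightarrow> 'd example"

definition data_mat :: "('m::finite, 'd::finite) sample \<Rightarrow> real ^ 'm ^ 'd" where
  "data_mat S = (\<chi> k i. fst (S i) $ k)"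

definition gram :: "('m::finite, 'd::finite) sample \<Rightarrow> real ^ 'm ^ 'm" where
  "gram S = transpose (data_mat S) ** data_mat S"

definition label_diag :: "('m::finite, 'd::finite) sample \<Rightarrow> real ^ 'm ^ 'm" where
  "label_diag S = (\<chi> i j. if i = j then snd (S i) else 0)"

definition label_outer :: "('m::finite, 'd::finite) sample \<Rightarrow> real ^ 'm ^ 'm" where
  "label_outer S = (\<chi> i j. snd (S i) * snd (S j))"

definition var_mat :: "real \<Rightarrow> ('m::finite, 'd::finite) sample \<Rightarrow> real ^ 'm ^ 'm" where
  "var_mat lam1 S =
     (2 * lam1 / (real CARD('m))\<^sup>2) *\<^sub>R (real CARD('m) *\<^sub>R mat 1 - label_outer S)"

text \<open>
  For \<open>lam1 \<ge> 0\<close> and labels in \<open>{-1, 1}\<close> the matrices \<open>var_mat lam1 S\<close> and \<open>gram S\<close> are positive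
  semidefinite, so \<open>mat 1 + var_mat lam1 S ** gram S\<close> is invertible and the use of
  \<^const>\<open>matrix_inv\<close> is genuine.
\<close>

definition odm_inv :: "real \<Rightarrow> ('m::finite, 'd::finite) sample \<Rightarrow> real ^ 'm ^ 'm" where
  "odm_inv lam1 S = matrix_inv (mat 1 + var_mat lam1 S ** gram S)"

definition odm_H :: "real \<Rightarrow> ('m::finite, 'd::finite) sample \<Rightarrow> real ^ 'm ^ 'm" where
  "odm_H lam1 S = label_diag S ** gram S ** odm_inv lam1 S ** label_diag S"

definition odm_dual ::
  "real \<Rightarrow> real \<Rightarrow> ('m::finite, 'd::finite) sample \<Rightarrow> real ^ 'm \<Rightarrow> real" where
  "odm_dual lam1 lam2 S \<alpha> =
     1 / 2 * (\<alpha> \<bullet> (odm_H lam1 S *v \<alpha>))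
     + ((lam2 / real CARD('m)) *\<^sub>R (odm_H lam1 S *v vec 1) - vec 1) \<bullet> \<alpha>"

definition dual_feasible :: "real \<Rightarrow> real ^ 'm::finite \<Rightarrow> bool" where
  "dual_feasible C \<alpha> \<longleftrightarrow> (\<forall>i. 0 \<le> \<alpha> $ i \<and> \<alpha> $ i \<le> C / real CARD('m))"

definition odm_optimal ::
  "real \<Rightarrow> real \<Rightarrow> real \<Rightarrow> ('m::finite, 'd::finite) sample \<Rightarrow> real ^ 'm \<Rightarrow> bool" where
  "odm_optimal lam1 lam2 C S \<alpha> \<longleftrightarrow> is_arg_min (odm_dual lam1 lam2 S) (dual_feasible C) \<alpha>"

text \<open>
  Leaving out example \<open>i\<close> adds the constraint \<open>\<alpha>\<^sub>i = 0\<close>; objective and box are those of the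
  full sample.
\<close>

definition odm_loo_optimal ::
  "real \<Rightarrow> real \<Rightarrow> real \<Rightarrow> ('m::finite, 'd::finite) sample \<Rightarrow> 'm \<Rightarrow> real ^ 'm \<Rightarrow> bool" where
  "odm_loo_optimal lam1 lam2 C S i \<alpha> \<longleftrightarrow>
     is_arg_min (odm_dual lam1 lam2 S) (\<lambda>\<beta>. dual_feasible C \<beta> \<and> \<beta> $ i = 0) \<alpha>"

definition primal_vec ::
  "real \<Rightarrow> real \<Rightarrow> ('m::finite, 'd::finite) sample \<Rightarrow> real ^ 'm \<Rightarrow> real ^ 'd" where
  "primal_vec lam1 lam2 S \<alpha> =
     (data_mat S ** odm_inv lam1 S ** label_diag S) *v
       ((lam2 / real CARD('m)) *\<^sub>R vec 1 + \<alpha>)"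

definition misclassified :: "real ^ 'd::finite \<Rightarrow> 'd example \<Rightarrow> bool" where
  "misclassified w z \<longleftrightarrow> snd z * (w \<bullet> fst z) < 0"

definition label_distribution :: "'d::finite example measure \<Rightarrow> bool" where
  "label_distribution D \<longleftrightarrow>
     prob_space D \<and> sets D = sets (borel \<Otimes>\<^sub>M count_space {-1, 1})"

definition iid_samples ::
  "'d::finite example measure \<Rightarrow> ('m::finite, 'd) sample measure" where
  "iid_samples D = PiM UNIV (\<lambda>_. D)"

definition test_error ::
  "'d::finite example measure \<Rightarrow> real \<Rightarrow> real \<Rightarrow> ('m::finite, 'd) sample \<Rightarrow> real ^ 'm \<Rightarrow> real" where
  "test_error D lam1 lam2 S \<alpha> =
     measure D {z \<in> space D. misclassified (primal_vec lam1 lam2 S \<alpha>) z}"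

text \<open>In \<open>loo_errors\<close>, \<open>\<beta> i\<close> is the dual vector learned with example \<open>i\<close> left out.\<close>

definition loo_errors ::
  "real \<Rightarrow> real \<Rightarrow> ('m::finite, 'd::finite) sample \<Rightarrow> ('m \<Rightarrow> real ^ 'm) \<Rightarrow> nat" where
  "loo_errors lam1 lam2 S \<beta> = card {i. misclassified (primal_vec lam1 lam2 S (\<beta> i)) (S i)}"

definition free_idx :: "real \<Rightarrow> real ^ 'm::finite \<Rightarrow> 'm set" where
  "free_idx C \<alpha> = {i. 0 < \<alpha> $ i \<and> \<alpha> $ i < C / real CARD('m)}"

definition bound_idx :: "real \<Rightarrow> real ^ 'm::finite \<Rightarrow> 'm set" where
  "bound_idx C \<alpha> = {i. \<alpha> $ i = C / real CARD('m)}"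

text \<open>
  Expectations of nonnegative quantities over the draw of the sample are taken in
  \<^typ>\<open>ennreal\<close>: the diagonal of \<open>odm_H\<close> need not be integrable, in which case the bound is
  \<open>\<infinity>\<close>, whereas the Bochner integral would silently be \<open>0\<close>.
\<close>

definition expected_test_error ::
  "'d::finite example measure \<Rightarrow> real \<Rightarrow> real \<Rightarrow> (('m::finite, 'd) sample \<Rightarrow> real ^ 'm) \<Rightarrow> ennreal"
where
  "expected_test_error D lam1 lam2 \<alpha> =
     (\<integral>\<^sup>+ S. ennreal (test_error D lam1 lam2 S (\<alpha> S)) \<partial>iid_samples D)"

definition expected_loo_errors ::
  "'d::finite example measure \<Rightarrow> real \<Rightarrow> real \<Rightarrow>
     (('m::finite, 'd) sample \<Rightarrow> 'm \<Rightarrow> real ^ 'm) \<Rightarrow> ennreal"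
where
  "expected_loo_errors D lam1 lam2 \<beta> =
     (\<integral>\<^sup>+ S. of_nat (loo_errors lam1 lam2 S (\<beta> S)) \<partial>iid_samples D)"

end

theory Submission
  imports Defs
begin

text \<open>
  The bound holds sample by sample. The margin \<open>y\<^sub>i (w \<bullet> x\<^sub>i)\<close> of a dual vector \<open>\<beta>\<close> is one
  plus the \<open>i\<close>-th partial derivative \<open>g\<^sub>i(\<beta>)\<close> of the dual objective \<open>f\<close>, so example \<open>i\<close> is a
  leave-one-out error only if \<open>g\<^sub>i(\<beta>\<^sup>i) < -1\<close>. If \<open>0 < \<alpha>\<^sub>i < C / m\<close>, then \<open>g\<^sub>i(\<alpha>) = 0\<close>, and
  exchanging the \<open>i\<close>-th coordinate between the two minimisers gives
  \<open>f(\<beta>\<^sup>i) \<le> f(\<alpha> - \<alpha>\<^sub>i e\<^sub>i) = f(\<alpha>) + \<alpha>\<^sub>i\<^sup>2 h\<^sub>i\<^sub>i / 2\<close> and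
  \<open>f(\<alpha>) \<le> f(\<beta>\<^sup>i + \<alpha>\<^sub>i e\<^sub>i) = f(\<beta>\<^sup>i) + \<alpha>\<^sub>i g\<^sub>i(\<beta>\<^sup>i) + \<alpha>\<^sub>i\<^sup>2 h\<^sub>i\<^sub>i / 2\<close>,
  hence \<open>\<alpha>\<^sub>i h\<^sub>i\<^sub>i \<ge> - g\<^sub>i(\<beta>\<^sup>i) > 1\<close>. If \<open>\<alpha>\<^sub>i = 0\<close>, then \<open>f(\<beta>\<^sup>i) \<le> f(\<alpha>)\<close>, and moving \<open>\<beta>\<^sup>i\<close> along
  \<open>e\<^sub>i\<close> shows \<open>g\<^sub>i(\<beta>\<^sup>i) \<ge> 0\<close>. That the margins are given by the gradient rests on the
  symmetry of \<open>H\<close>, hence on \<open>I + A G\<close> being invertible.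
\<close>

section \<open>Matrices of the form I + A G, and the symmetry of \<open>odm_H\<close>\<close>

lemma transpose_add: "transpose (A + B) = transpose A + transpose (B :: 'a::plus ^ 'n ^ 'm)"
  by (simp add: transpose_def vec_eq_iff)

lemma matrix_mult_add_rdistrib:
  "(A + B) ** C = A ** C + B ** (C :: 'a::semiring_1 ^ 'n ^ 'k)"
  by (simp add: vec_eq_iff matrix_matrix_mult_def distrib_right sum.distrib)

text \<open>The kernel is trivial: a kernel vector v satisfies v = - A u with u the image of v under
  the Gram matrix of X. Then the squared norm of X v is u \<bullet> v = - u \<bullet> A u \<le> 0,
  which forces X v = 0, u = 0 and v = 0 in turn.\<close>

lemma invertible_one_plus_psd_mult:
  fixes A :: "real ^ 'n ^ 'n" and X :: "real ^ 'n ^ 'k"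
  assumes "\<And>u. 0 \<le> u \<bullet> (A *v u)"
  shows "invertible (mat 1 + A ** (transpose X ** X))"
proof -
  have "v = 0" if v: "(mat 1 + A ** (transpose X ** X)) *v v = 0" for v
  proof -
    define u where "u = transpose X *v (X *v v)"
    have "v + A *v u = 0"
      using v by (simp add: u_def matrix_vector_mult_add_rdistrib matrix_vector_mul_assoc matrix_mul_assoc)
    then have vA: "v = - (A *v u)"
      by (simp add: eq_neg_iff_add_eq_0)
    have "(X *v v) \<bullet> (X *v v) = u \<bullet> v"
      by (simp add: u_def transpose_matrix_vector dot_lmul_matrix)
    also have "\<dots> = - (u \<bullet> (A *v u))"
      using vA by (metis inner_minus_right)
    also have "\<dots> \<le> 0"
      using assms by simp
    finally have "X *v v = 0"
      by (metis inner_gt_zero_iff not_less)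
    then have "u = 0"
      by (simp add: u_def)
    then show "v = 0"
      using vA by simp
  qed
  then show ?thesis
    by (metis invertible_left_inverse matrix_left_invertible_ker)
qed

lemma mult_matrix_inv:
  assumes "invertible P"
  shows "P ** matrix_inv P = mat 1"
  using someI_ex[OF assms[unfolded invertible_def]] by (simp add: matrix_inv_def)

text \<open>With P = I + A G, both G P and the transpose of P times G equal G + G A G. Multiplying
  by the transposed inverse of P on the left and the inverse on the right moves P across G.\<close>

lemma symmetric_mult_inv_one_plus:
  fixes A G :: "real ^ 'n ^ 'n"
  assumes "transpose A = A" "transpose G = G" "invertible (mat 1 + A ** G)"
  shows "transpose (G ** matrix_inv (mat 1 + A ** G)) = G ** matrix_inv (mat 1 + A ** G)"
proof -
  define P where "P = mat 1 + A ** G"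
  define Q where "Q = matrix_inv P"
  have PQ: "P ** Q = mat 1"
    using mult_matrix_inv[of P] assms(3) by (simp add: P_def Q_def)
  have "G ** P = transpose P ** G"
    by (simp add: P_def matrix_add_ldistrib matrix_mult_add_rdistrib transpose_add matrix_transpose_mul
        assms matrix_mul_assoc)
  then have "transpose Q ** (G ** P) ** Q = transpose Q ** (transpose P ** G) ** Q"
    by simp
  then have "transpose Q ** G ** (P ** Q) = transpose (P ** Q) ** G ** Q"
    by (simp add: matrix_mul_assoc matrix_transpose_mul)
  then show ?thesis
    by (simp add: PQ matrix_transpose_mul assms flip: P_def Q_def)
qed

text \<open>Up to a nonnegative factor the quadratic form is m (u \<bullet> u) minus the square of y
  \<bullet> u. This is the Cauchy-Schwarz inequality, because labels of modulus one give y \<bullet>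
  y = m.\<close>

lemma var_mat_psd:
  fixes S :: "('m::finite, 'd::finite) sample"
  assumes "lam1 \<ge> 0" and labels: "\<And>i. snd (S i) \<in> {-1, 1}"
  shows "0 \<le> u \<bullet> (var_mat lam1 S *v u)"
proof -
  define y :: "real ^ 'm" where "y = (\<chi> i. snd (S i))"
  have "snd (S i) * snd (S i) = 1" for i
    using labels[of i] by auto
  then have "y \<bullet> y = real CARD('m)"
    by (simp add: y_def inner_vec_def)
  then have cs: "(y \<bullet> u)\<^sup>2 \<le> real CARD('m) * (u \<bullet> u)"
    using Cauchy_Schwarz_ineq[of y u] by simp
  have outer: "label_outer S *v u = (y \<bullet> u) *\<^sub>R y"
    by (simp add: vec_eq_iff matrix_vector_mult_def label_outer_def y_def inner_vec_def
        sum_distrib_left mult_ac)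
  have "var_mat lam1 S *v u
      = (2 * lam1 / (real CARD('m))\<^sup>2) *\<^sub>R (real CARD('m) *\<^sub>R u - (y \<bullet> u) *\<^sub>R y)"
    by (simp add: var_mat_def outer matrix_vector_mult_diff_rdistrib flip: scaleR_matrix_vector_assoc)
  then have "u \<bullet> (var_mat lam1 S *v u)
      = 2 * lam1 / (real CARD('m))\<^sup>2 * (real CARD('m) * (u \<bullet> u) - (y \<bullet> u)\<^sup>2)"
    by (simp add: inner_diff_right power2_eq_square inner_commute)
  then show ?thesis
    using cs assms(1) by simp
qed

lemma transpose_odm_H:
  fixes S :: "('m::finite, 'd::finite) sample"
  assumes "lam1 \<ge> 0" and "\<And>i. snd (S i) \<in> {-1, 1}"
  shows "transpose (odm_H lam1 S) = odm_H lam1 S"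
proof -
  have "invertible (mat 1 + var_mat lam1 S ** gram S)"
    unfolding gram_def by (intro invertible_one_plus_psd_mult var_mat_psd assms)
  moreover have "transpose (var_mat lam1 S) = var_mat lam1 S"
    by (simp add: vec_eq_iff transpose_def var_mat_def label_outer_def mat_def mult.commute)
  moreover have "transpose (gram S) = gram S"
    by (simp add: gram_def matrix_transpose_mul)
  ultimately have "transpose (gram S ** odm_inv lam1 S) = gram S ** odm_inv lam1 S"
    unfolding odm_inv_def by (rule symmetric_mult_inv_one_plus[rotated 2])
  moreover have "transpose (label_diag S) = label_diag S"
    by (auto simp: vec_eq_iff transpose_def label_diag_def)
  moreover have "odm_H lam1 S = label_diag S ** (gram S ** odm_inv lam1 S) ** label_diag S"
    by (simp add: odm_H_def matrix_mul_assoc)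
  ultimately show ?thesis
    by (simp add: matrix_transpose_mul matrix_mul_assoc)
qed

section \<open>The dual objective along a coordinate direction\<close>

definition odm_grad ::
  "real \<Rightarrow> real \<Rightarrow> ('m::finite, 'd::finite) sample \<Rightarrow> real ^ 'm \<Rightarrow> real ^ 'm" where
  "odm_grad lam1 lam2 S \<alpha> =
     odm_H lam1 S *v ((lam2 / real CARD('m)) *\<^sub>R vec 1 + \<alpha>) - vec 1"

text \<open>\<open>odm_grad\<close> applies \<open>odm_H\<close> to the same shifted vector that
  \<open>primal_vec\<close> uses. Splitting the Gram matrix inside \<open>odm_H\<close> exposes the
  primal vector w, and what is left on its left sends w to the vector of margins.\<close>

lemma margin_eq_odm_grad:
  fixes S :: "('m::finite, 'd::finite) sample"
  shows
  "snd (S i) * (primal_vec lam1 lam2 S \<alpha> \<bullet> fst (S i)) = odm_grad lam1 lam2 S \<alpha> $ i + 1"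
proof -
  define v where "v = (odm_inv lam1 S ** label_diag S) *v ((lam2 / real CARD('m)) *\<^sub>R vec 1 + \<alpha>)"
  have diag: "(label_diag S *v u) $ i = snd (S i) * u $ i" for u
    by (simp add: matrix_vector_mult_def label_diag_def if_distrib[of "\<lambda>a. a * _"] cong: if_cong)
  have w: "primal_vec lam1 lam2 S \<alpha> = data_mat S *v v"
    by (simp add: primal_vec_def v_def matrix_vector_mul_assoc matrix_mul_assoc)
  have "odm_grad lam1 lam2 S \<alpha> + vec 1 = label_diag S *v (transpose (data_mat S) *v (data_mat S *v v))"
    by (simp add: odm_grad_def odm_H_def gram_def v_def matrix_vector_mul_assoc matrix_mul_assoc)
  then have "odm_grad lam1 lam2 S \<alpha> $ i + 1 = (label_diag S *v (transpose (data_mat S) *v (data_mat S *v v))) $ i"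
    by (metis vec_component vector_add_component)
  moreover have "(transpose (data_mat S) *v w) $ i = w \<bullet> fst (S i)" for w
    by (simp add: matrix_vector_mult_def transpose_def data_mat_def inner_vec_def mult.commute)
  ultimately show ?thesis
    by (simp add: w diag)
qed

text \<open>The Taylor expansion of a quadratic is exact at second order. Symmetry merges the two
  cross terms, which makes \<open>odm_grad\<close> the true gradient.\<close>

lemma odm_dual_add_axis:
  fixes S :: "('m::finite, 'd::finite) sample"
  assumes sym: "transpose (odm_H lam1 S) = odm_H lam1 S"
  shows "odm_dual lam1 lam2 S (\<alpha> + axis i t) =
    odm_dual lam1 lam2 S \<alpha> + t * odm_grad lam1 lam2 S \<alpha> $ i + t\<^sup>2 * odm_H lam1 S $ i $ i / 2"
proof -
  define H where "H = odm_H lam1 S"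
  have "u \<bullet> (H *v v) = (H *v u) \<bullet> v" for u v
    by (metis H_def sym dot_lmul_matrix transpose_matrix_vector)
  then have self: "\<alpha> \<bullet> (H *v axis i t) = (H *v \<alpha>) \<bullet> axis i t" .
  have "(H *v axis i t) $ i = t * H $ i $ i"
    by (simp add: matrix_vector_mult_def axis_def if_distrib[of "\<lambda>a. _ * a"] cong: if_cong)
  then show ?thesis
    unfolding odm_dual_def odm_grad_def H_def[symmetric]
    by (simp add: self matrix_vector_right_distrib inner_add_left inner_add_right inner_diff_left
        inner_axis inner_axis' matrix_vector_mult_scaleR algebra_simps power2_eq_square add_divide_distrib)
qed

lemma dual_feasible_add_axis:
  assumes "dual_feasible C \<alpha>" "0 \<le> \<alpha> $ i + t" "\<alpha> $ i + t \<le> C / real CARD('m)"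
  shows "dual_feasible C (\<alpha> + axis i t :: real ^ 'm::finite)"
  using assms by (auto simp: dual_feasible_def axis_def)

lemma odm_optimal_le:
  assumes "odm_optimal lam1 lam2 C S \<alpha>" "dual_feasible C \<beta>"
  shows "odm_dual lam1 lam2 S \<alpha> \<le> odm_dual lam1 lam2 S \<beta>"
  using assms by (auto simp: odm_optimal_def is_arg_min_def not_less)

lemma odm_loo_optimal_le:
  assumes "odm_loo_optimal lam1 lam2 C S i \<beta>" "dual_feasible C \<alpha>" "\<alpha> $ i = 0"
  shows "odm_dual lam1 lam2 S \<beta> \<le> odm_dual lam1 lam2 S \<alpha>"
  using assms by (auto simp: odm_loo_optimal_def is_arg_min_def not_less)

text \<open>First-order optimality at the end of an interval: for small t the linear term dominates
  the quadratic one.\<close>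

lemma linear_le_quadratic_imp_nonneg:
  fixes g h r :: real
  assumes "r > 0" and "\<And>t. 0 < t \<Longrightarrow> t \<le> r \<Longrightarrow> 0 \<le> t * g + t\<^sup>2 * h / 2"
  shows "0 \<le> g"
proof (rule ccontr)
  assume "\<not> 0 \<le> g"
  \<comment> \<open>This t is so short that t \<bar>h\<bar> + t \<le> - g, so the quadratic term
    cannot make up for a negative g.\<close>
  define t where "t = min r (- g / (\<bar>h\<bar> + 1))"
  have t: "0 < t" "t \<le> r" "t \<le> - g / (\<bar>h\<bar> + 1)"
    using \<open>\<not> 0 \<le> g\<close> \<open>r > 0\<close> by (auto simp: t_def intro!: divide_neg_pos)
  have t_le: "t * (\<bar>h\<bar> + 1) \<le> - g"
    using t(3) by (subst (asm) pos_le_divide_eq) auto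
  have "0 \<le> t * (g + t * h / 2)"
    using assms(2)[OF t(1,2)] by (simp add: power2_eq_square algebra_simps)
  then have "0 \<le> g + t * h / 2"
    using t(1) by (simp add: zero_le_mult_iff)
  moreover have "t * h \<le> t * \<bar>h\<bar>" and "0 \<le> t * \<bar>h\<bar>"
    using t(1) by (simp_all add: mult_left_mono)
  moreover have "t + t * \<bar>h\<bar> \<le> - g"
    using t_le by (simp add: algebra_simps)
  ultimately show False
    using t(1) by linarith
qed

section \<open>Comparing the dual optimum with a leave-one-out optimum\<close>

context
  fixes S :: "('m::finite, 'd::finite) sample" and lam1 lam2 C :: real and \<alpha> :: "real ^ 'm"
  assumes sym: "transpose (odm_H lam1 S) = odm_H lam1 S"
    and opt: "odm_optimal lam1 lam2 C S \<alpha>"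
begin

lemma feasible: "dual_feasible C \<alpha>"
  using opt by (simp add: odm_optimal_def is_arg_min_def)

text \<open>A free coordinate can move both ways inside the box, so the linear term vanishes. The
  remaining quadratic term then gives the sign of the diagonal entry, which thus comes from
  optimality rather than from semidefiniteness of \<open>odm_H\<close>.\<close>

lemma free_idx_stationary:
  assumes "i \<in> free_idx C \<alpha>"
  shows "odm_grad lam1 lam2 S \<alpha> $ i = 0" and "0 \<le> odm_H lam1 S $ i $ i"
proof -
  define g where "g = odm_grad lam1 lam2 S \<alpha> $ i"
  define h where "h = odm_H lam1 S $ i $ i"
  define r where "r = min (\<alpha> $ i) (C / real CARD('m) - \<alpha> $ i)"
  have r: "r > 0"
    using assms by (simp add: r_def free_idx_def)
  have step: "0 \<le> t * g + t\<^sup>2 * h / 2" if "\<bar>t\<bar> \<le> r" for t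
  proof -
    have "dual_feasible C (\<alpha> + axis i t)"
      using that by (intro dual_feasible_add_axis feasible) (auto simp: r_def)
    then show ?thesis
      using odm_optimal_le[OF opt] odm_dual_add_axis[OF sym, of lam2 \<alpha> i t]
      by (fastforce simp: g_def h_def)
  qed
  have "0 \<le> g"
    using r step by (intro linear_le_quadratic_imp_nonneg[of r g h]) auto
  moreover have "0 \<le> - g"
    \<comment> \<open>Reversing the direction flips the sign of g and keeps the quadratic
      term.\<close>
    using r step[of "- t" for t] by (intro linear_le_quadratic_imp_nonneg[of r "- g" h]) auto
  ultimately show g: "odm_grad lam1 lam2 S \<alpha> $ i = 0"
    by (simp add: g_def)
  show "0 \<le> odm_H lam1 S $ i $ i"
    using step[of r] r g by (simp add: g_def h_def zero_le_mult_iff)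
qed

lemma loo_error_bound:
  assumes "C > 0" and loo: "odm_loo_optimal lam1 lam2 C S i \<beta>"
    and mis: "misclassified (primal_vec lam1 lam2 S \<beta>) (S i)"
  shows "i \<in> bound_idx C \<alpha> \<or> i \<in> free_idx C \<alpha> \<and> 1 \<le> \<alpha> $ i * odm_H lam1 S $ i $ i"
proof -
  define g where "g = odm_grad lam1 lam2 S \<beta> $ i"
  define h where "h = odm_H lam1 S $ i $ i"
  define f where "f = odm_dual lam1 lam2 S"
  define a where "a = \<alpha> $ i"
  have g: "g < -1"
    using mis margin_eq_odm_grad[of S i lam1 lam2 \<beta>] by (simp add: misclassified_def g_def)
  have \<beta>: "dual_feasible C \<beta>" "\<beta> $ i = 0"
    using loo by (auto simp: odm_loo_optimal_def is_arg_min_def)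
  \<comment> \<open>Coordinate i of \<beta> is 0, so the step length t is its new value and the box
    allows all of 0 \<le> t \<le> C / m.\<close>
  have up: "f \<alpha> \<le> f \<beta> + t * g + t\<^sup>2 * h / 2" if "0 \<le> t" "t \<le> C / real CARD('m)" for t
    using odm_optimal_le[OF opt dual_feasible_add_axis[OF \<beta>(1), of i t]]
      odm_dual_add_axis[OF sym, of lam2 \<beta> i t] that \<beta>(2)
    by (simp add: g_def h_def f_def)
  have a: "0 \<le> a" "a \<le> C / real CARD('m)"
    using feasible by (auto simp: dual_feasible_def a_def)
  have "a \<noteq> 0"
  proof
    assume "a = 0"
    then have "f \<beta> \<le> f \<alpha>"
      using odm_loo_optimal_le[OF loo feasible] by (simp add: f_def a_def)
    then have "0 \<le> t * g + t\<^sup>2 * h / 2" if "0 < t" "t \<le> C / real CARD('m)" for t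
      using up[of t] that by simp
    then have "0 \<le> g"
      using \<open>C > 0\<close> by (intro linear_le_quadratic_imp_nonneg[of "C / real CARD('m)" g h]) auto
    then show False
      using g by simp
  qed
  moreover have "1 \<le> a * h" if free: "i \<in> free_idx C \<alpha>"
  proof -
    have "0 < a"
      using free by (simp add: free_idx_def a_def)
    have "f \<beta> \<le> f (\<alpha> + axis i (- a))"
      unfolding f_def using feasible a
      by (intro odm_loo_optimal_le[OF loo] dual_feasible_add_axis) (auto simp: a_def)
    also have "\<dots> = f \<alpha> + a\<^sup>2 * h / 2"
      using odm_dual_add_axis[OF sym, of lam2 \<alpha> i "- a"] free_idx_stationary(1)[OF free]
      by (simp add: f_def h_def)
    \<comment> \<open>Chaining with \<open>up\<close> at t = a cancels the objective values and adds
      the two halves of the quadratic term.\<close>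
    finally have "0 \<le> a * (g + a * h)"
      using up[OF a] by (simp add: algebra_simps power2_eq_square)
    then show ?thesis
      using \<open>0 < a\<close> g by (simp add: zero_le_mult_iff)
  qed
  ultimately show ?thesis
    using a by (auto simp: free_idx_def bound_idx_def a_def h_def)
qed

text \<open>An error at a bound index is paid for by the cardinality, an error at a free index by
  its own summand, which is at least 1. Free summands without an error are nonnegative and can be
  added.\<close>

lemma loo_errors_le:
  assumes "C > 0" and loo: "\<And>i. odm_loo_optimal lam1 lam2 C S i (\<beta> i)"
  shows "real (loo_errors lam1 lam2 S \<beta>) \<le>
    (\<Sum>i\<in>free_idx C \<alpha>. \<alpha> $ i * odm_H lam1 S $ i $ i) + real (card (bound_idx C \<alpha>))"
proof -
  define h where "h i = \<alpha> $ i * odm_H lam1 S $ i $ i" for i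
  define F where "F = {i \<in> free_idx C \<alpha>. 1 \<le> h i}"
  have "loo_errors lam1 lam2 S \<beta> \<le> card (F \<union> bound_idx C \<alpha>)"
    unfolding loo_errors_def
    using loo_error_bound[OF \<open>C > 0\<close> loo] by (intro card_mono) (auto simp: F_def h_def)
  also have "\<dots> \<le> card F + card (bound_idx C \<alpha>)"
    by (rule card_Un_le)
  finally have "real (loo_errors lam1 lam2 S \<beta>) \<le> (\<Sum>i\<in>F. 1) + real (card (bound_idx C \<alpha>))"
    by simp
  also have "(\<Sum>i\<in>F. 1) \<le> (\<Sum>i\<in>F. h i)"
    by (intro sum_mono) (auto simp: F_def)
  also have "\<dots> \<le> (\<Sum>i\<in>free_idx C \<alpha>. h i)"
    using free_idx_stationary(2)
    by (intro sum_mono2) (auto simp: F_def h_def free_idx_def intro!: mult_nonneg_nonneg)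
  finally show ?thesis
    by (simp add: h_def)
qed

end

section \<open>From samples to expectations\<close>

lemma iid_samples_labels:
  assumes "label_distribution D" "S \<in> space (iid_samples D)"
  shows "snd (S i) \<in> {-1, 1}"
proof -
  have "sets D = sets (borel \<Otimes>\<^sub>M count_space {-1, 1})"
    using assms(1) unfolding label_distribution_def by blast
  then have "space D = UNIV \<times> {-1, 1}"
    by (drule_tac sets_eq_imp_space_eq) (simp add: space_pair_measure)
  moreover have "S i \<in> space D"
    using assms(2) unfolding iid_samples_def space_PiM by blast
  ultimately show ?thesis
    by (metis SigmaE snd_conv)
qed

text \<open>The leave-one-out identity appears as the premise of the second conjunct. The first
  conjunct bounds the expected leave-one-out error without it.\<close>

theorem theorem2:
  fixes D :: "'d::finite example measure"
    and lam1 lam2 C :: real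
    and \<alpha> :: "('m::finite, 'd) sample \<Rightarrow> real ^ 'm"
    and \<beta> :: "('m, 'd) sample \<Rightarrow> 'm \<Rightarrow> real ^ 'm"
  assumes "label_distribution D"
    and "lam1 \<ge> 0" and "lam2 \<ge> 0" and "C > 0"
    and "\<alpha> \<in> borel_measurable (iid_samples D)"
    and "\<And>S. S \<in> space (iid_samples D) \<Longrightarrow> odm_optimal lam1 lam2 C S (\<alpha> S)"
    and "\<And>S i. S \<in> space (iid_samples D) \<Longrightarrow> odm_loo_optimal lam1 lam2 C S i (\<beta> S i)"
  shows "let m = CARD('m);
             bound = (\<integral>\<^sup>+ S. ennreal ((\<Sum>i\<in>free_idx C (\<alpha> S). \<alpha> S $ i * odm_H lam1 S $ i $ i)
                                  + real (card (bound_idx C (\<alpha> S)))) \<partial>iid_samples D) / of_nat m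
         in expected_loo_errors D lam1 lam2 \<beta> / of_nat m \<le> bound
            \<and> (expected_test_error D lam1 lam2 \<alpha> = expected_loo_errors D lam1 lam2 \<beta> / of_nat m
                 \<longrightarrow> expected_test_error D lam1 lam2 \<alpha> \<le> bound)"
proof -
  have "of_nat (loo_errors lam1 lam2 S (\<beta> S))
      \<le> ennreal ((\<Sum>i\<in>free_idx C (\<alpha> S). \<alpha> S $ i * odm_H lam1 S $ i $ i)
          + real (card (bound_idx C (\<alpha> S))))" if S: "S \<in> space (iid_samples D)" for S
  proof -
    \<comment> \<open>Labels lie in {-1, 1} at every point of the sample space, not just almost
      surely, so the bound is pointwise.\<close>
    have "transpose (odm_H lam1 S) = odm_H lam1 S"
      using assms(1,2) S by (intro transpose_odm_H iid_samples_labels) auto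
    then show ?thesis
      using loo_errors_le[OF _ assms(6)[OF S] assms(4), of "\<beta> S"] assms(7)[OF S]
      by (simp add: ennreal_of_nat_eq_real_of_nat ennreal_leI)
  qed
  then have "expected_loo_errors D lam1 lam2 \<beta> / of_nat CARD('m)
      \<le> (\<integral>\<^sup>+ S. ennreal ((\<Sum>i\<in>free_idx C (\<alpha> S). \<alpha> S $ i * odm_H lam1 S $ i $ i)
          + real (card (bound_idx C (\<alpha> S)))) \<partial>iid_samples D) / of_nat CARD('m)"
    unfolding expected_loo_errors_def by (intro divide_right_mono_ennreal nn_integral_mono)
  then show ?thesis
    by (simp add: Let_def)
qed

end
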